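(* For each integer $m\ge 1$, the polynomial $f_m(x)=x^m(1-x)^m$ satisfies $$f_m(x)=\frac{1}{(2m+1)\binom{2m}{m}}+(-1)^m\sum_{j=m+1}^{2m}\frac{1+(-1)^j}{j}\binom{m}{j-m-1}B_j(x).$$
   Context: $B_n(x)$ are the Bernoulli polynomials, defined by $\frac{te^{xt}}{e^t-1}=\sum_{n=0}^{\infty}B_n(x)\frac{t^n}{n!}$. *)

theory Defs
  imports "HOL-Computational_Algebra.Computational_Algebra"
begin

(* The generating function t e^(xt) / (e^t - 1), as a power series in t with coefficients in K[x].
   The factor t / (e^t - 1) does not involve x, so it is formed over the field K, where power series
   division cancels the common factor t, and its coefficients are then read as constant polynomials. *)
definition bernoulli_gf :: "'a::field_char_0 poly fps" where
  "bernoulli_gf = Abs_fps (\<lambda>n. monom (1 / fact n) n) *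
     Abs_fps (\<lambda>n. [:fps_nth (fps_X / (fps_exp 1 - 1)) n:])"

definition bernoulli_poly :: "nat \<Rightarrow> 'a::field_char_0 poly" where
  "bernoulli_poly n = smult (fact n) (fps_nth bernoulli_gf n)"

lemma bernoulli_poly_generating_function:
  fixes x :: "'a::field_char_0"
  shows "Abs_fps (\<lambda>n. poly (bernoulli_poly n) x / fact n) = fps_X * fps_exp x / (fps_exp 1 - 1)"
proof -
  have dvd: "(fps_exp 1 - 1 :: 'a fps) dvd fps_X"
  proof -
    have "fps_nth (fps_exp 1 - 1 :: 'a fps) 1 \<noteq> 0" by simp
    hence "subdegree (fps_exp 1 - 1 :: 'a fps) \<le> 1" by (rule subdegree_leI)
    moreover have "(fps_exp 1 - 1 :: 'a fps) \<noteq> 0"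
      using \<open>fps_nth (fps_exp 1 - 1 :: 'a fps) 1 \<noteq> 0\<close> by fastforce
    ultimately show ?thesis by (simp add: fps_dvd_iff)
  qed
  have "Abs_fps (\<lambda>n. poly (bernoulli_poly n) x / fact n)
      = fps_exp x * (fps_X / (fps_exp 1 - 1))"
    by (rule fps_ext)
       (simp add: bernoulli_poly_def bernoulli_gf_def fps_mult_nth poly_sum poly_monom mult.commute)
  also have "\<dots> = fps_X * fps_exp x / (fps_exp 1 - 1)"
    using dvd by (simp add: div_mult_swap mult.commute)
  finally show ?thesis .
qed

end

theory Submission
  imports Defs
begin

text \<open>
  Write \<open>f = x^m (1 - x)^m\<close> and let \<open>S\<close> be the sum of Bernoulli polynomials, with its sign.
  Since \<open>B\<^sub>j(x + 1) - B\<^sub>j(x) = j x^(j - 1)\<close>, the forward difference of \<open>S\<close> is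
  \<open>(-1)^m x^m\<close> times \<open>\<Sum>k. (m choose k) (1 - (-1)^(m + k)) x^k\<close>, and the binomial theorem evaluates
  the latter sum to \<open>(x + 1)^m - (x - 1)^m\<close>.  This is exactly the forward difference of \<open>f\<close>,
  so \<open>f - S\<close> is a polynomial of period 1 and hence a constant
  (\<open>periodic_poly_const\<close>).

  The constant is found by integrating over \<open>[0, 1]\<close>: each \<open>B\<^sub>j\<close> with \<open>j \<ge> 1\<close> integrates to 0, as
  \<open>B\<^sub>j\<close> is the derivative of \<open>B\<^bsub>j+1\<^esub> / (j + 1)\<close> and \<open>B\<^bsub>j+1\<^esub>(1) = B\<^bsub>j+1\<^esub>(0)\<close>, while \<open>f\<close> has the
  beta integral \<open>(m!)^2 / (2m + 1)!\<close>.  The coefficients lie in an arbitrary field of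
  characteristic 0, so the integral is the algebraic one, given by an antiderivative.
\<close>

text \<open>Being a relation rather than a function, this makes linearity immediate and leaves
  well-definedness to the uniqueness lemma below.\<close>

definition has_unit_integral :: "'a::field_char_0 poly \<Rightarrow> 'a \<Rightarrow> bool" where
  "has_unit_integral p c \<longleftrightarrow> (\<exists>P. pderiv P = p \<and> poly P 1 - poly P 0 = c)"

lemma has_unit_integral_unique:
  assumes "has_unit_integral p c" "has_unit_integral p d"
  shows "c = d"
proof -
  obtain P Q where PQ: "pderiv P = p" "poly P 1 - poly P 0 = c"
      "pderiv Q = p" "poly Q 1 - poly Q 0 = d"
    using assms unfolding has_unit_integral_def by blast
  have "pderiv (P - Q) = 0"
    using PQ by (simp add: pderiv_diff)
  then obtain h where "P - Q = [:h:]"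
    using pderiv_iszero by blast
  hence "poly (P - Q) 1 = poly (P - Q) 0"
    by simp
  with PQ show ?thesis
    by (simp add: algebra_simps)
qed

lemma has_unit_integral_const: "has_unit_integral [:c:] c"
  unfolding has_unit_integral_def by (rule exI[of _ "[:0, c:]"]) (simp add: pderiv_pCons)

lemma has_unit_integral_add:
  assumes "has_unit_integral p c" "has_unit_integral q d"
  shows "has_unit_integral (p + q) (c + d)"
proof -
  obtain P Q where "pderiv P = p" "poly P 1 - poly P 0 = c"
      "pderiv Q = q" "poly Q 1 - poly Q 0 = d"
    using assms unfolding has_unit_integral_def by blast
  thus ?thesis
    unfolding has_unit_integral_def
    by (intro exI[of _ "P + Q"]) (auto simp: pderiv_add)
qed

lemma has_unit_integral_smult:
  assumes "has_unit_integral p c"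
  shows "has_unit_integral (smult a p) (a * c)"
proof -
  obtain P where "pderiv P = p" "poly P 1 - poly P 0 = c"
    using assms unfolding has_unit_integral_def by blast
  thus ?thesis
    unfolding has_unit_integral_def
    by (intro exI[of _ "smult a P"]) (auto simp: pderiv_smult algebra_simps)
qed

lemma has_unit_integral_sum:
  assumes "\<And>i. i \<in> A \<Longrightarrow> has_unit_integral (p i) (c i)"
  shows "has_unit_integral (\<Sum>i\<in>A. p i) (\<Sum>i\<in>A. c i)"
  using assms
  by (induction A rule: infinite_finite_induct)
     (auto intro: has_unit_integral_add simp: has_unit_integral_const[of 0, simplified])

text \<open>Integrating the derivative of \<open>x^(a + 1) (1 - x)^(c + 1)\<close>, which vanishes at both ends, moves
  one factor \<open>1 - x\<close> to a factor \<open>x\<close>; repeating this leaves a plain power of \<open>x\<close>.\<close>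

lemma has_unit_integral_beta:
  "has_unit_integral ([:0, 1:] ^ a * (1 - [:0, 1:]) ^ c :: 'a::field_char_0 poly)
     (fact a * fact c / fact (a + c + 1))"
proof (induction c arbitrary: a)
  case 0
  have "pderiv (smult (1 / of_nat (a + 1)) ([:0, 1:] ^ (a + 1))) = ([:0, 1:] ^ a :: 'a poly)"
    by (simp only: pderiv_smult Suc_eq_plus1[symmetric] pderiv_power_Suc)
       (simp add: pderiv_pCons del: of_nat_Suc)
  thus ?case
    unfolding has_unit_integral_def
    by (intro exI[of _ "smult (1 / of_nat (a + 1)) ([:0, 1:] ^ (a + 1))"])
       (simp add: pderiv_smult power_0_left add_divide_distrib[symmetric] del: of_nat_Suc)
next
  case (Suc c)
  let ?x = "[:0, 1:] :: 'a poly" and ?y = "1 - [:0, 1:] :: 'a poly"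
  let ?P = "?x ^ Suc a * ?y ^ Suc c"
  have deriv: "pderiv ?P = smult (of_nat (Suc a)) (?x ^ a * ?y ^ Suc c)
                         - smult (of_nat (Suc c)) (?x ^ Suc a * ?y ^ c)"
    by (simp only: pderiv_mult pderiv_power_Suc)
       (simp add: pderiv_diff pderiv_pCons algebra_simps del: of_nat_Suc power_Suc)
  have "has_unit_integral (pderiv ?P) 0"
    unfolding has_unit_integral_def by (intro exI[of _ ?P]) simp
  from has_unit_integral_smult[OF has_unit_integral_add[OF this
      has_unit_integral_smult[OF Suc.IH[of "Suc a"], of "of_nat (Suc c)"]],
      of "1 / of_nat (Suc a)"]
  have "has_unit_integral (?x ^ a * ?y ^ Suc c)
      (1 / of_nat (Suc a) * (0 + of_nat (Suc c) *
        (fact (Suc a) * fact c / fact (Suc a + c + 1))))"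
    unfolding deriv by (simp del: of_nat_Suc power_Suc)
  also have "1 / of_nat (Suc a) * (0 + of_nat (Suc c) *
        (fact (Suc a) * fact c / fact (Suc a + c + 1)))
      = (fact a * fact (Suc c) / fact (a + Suc c + 1) :: 'a)"
    by (simp add: fact_Suc[of a] fact_Suc[of c] del: of_nat_Suc fact_Suc)
  finally show ?case .
qed

text \<open>A period 1 forces the value at 0 at every natural number, and these are infinitely many
  points in characteristic 0.\<close>

lemma periodic_poly_const:
  fixes p :: "'a::field_char_0 poly"
  assumes "\<And>x. poly p (x + 1) = poly p x"
  shows "p = [:poly p 0:]"
proof (rule ccontr)
  assume "p \<noteq> [:poly p 0:]"
  hence "finite {x. poly (p - [:poly p 0:]) x = 0}"
    by (intro poly_roots_finite) simp
  moreover have "poly p (of_nat n) = poly p 0" for n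
    by (induction n) (simp_all add: assms add.commute[of 1])
  hence "range of_nat \<subseteq> {x. poly (p - [:poly p 0:]) x = 0}"
    by auto
  ultimately have "finite (range (of_nat :: nat \<Rightarrow> 'a))"
    using finite_subset by blast
  thus False
    using finite_imageD[of "of_nat :: nat \<Rightarrow> 'a" UNIV] by (auto simp: inj_of_nat)
qed

text \<open>Shifting \<open>x\<close> by 1 multiplies the generating function by \<open>e^t\<close>, so the difference
  cancels the denominator \<open>e^t - 1\<close> and leaves \<open>t e^(xt)\<close>.\<close>

lemma bernoulli_poly_forward_difference:
  fixes x :: "'a::field_char_0"
  assumes "n \<ge> 1"
  shows "poly (bernoulli_poly n) (x + 1) - poly (bernoulli_poly n) x = of_nat n * x ^ (n - 1)"
proof -
  let ?e = "fps_exp 1 - 1 :: 'a fps"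
  let ?B = "\<lambda>x :: 'a. Abs_fps (\<lambda>n. poly (bernoulli_poly n) x / fact n)"
  have "fps_nth ?e 1 \<noteq> 0"
    by simp
  hence e0: "?e \<noteq> 0"
    by fastforce
  have "subdegree ?e \<le> 1"
    using \<open>fps_nth ?e 1 \<noteq> 0\<close> by (rule subdegree_leI)
  hence dvd: "?e dvd fps_X"
    using e0 by (simp add: fps_dvd_iff)
  have B: "?B y * ?e = fps_X * fps_exp y" for y
    unfolding bernoulli_poly_generating_function using dvd by simp
  have "(?B (x + 1) - ?B x) * ?e = fps_X * fps_exp x * ?e"
    by (simp only: left_diff_distrib[of "?B (x + 1)"] B) (simp add: fps_exp_add_mult algebra_simps)
  hence "?B (x + 1) - ?B x = fps_X * fps_exp x"
    using e0 by simp
  hence "fps_nth (?B (x + 1) - ?B x) n = fps_nth (fps_X * fps_exp x) n"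
    by simp
  hence "(poly (bernoulli_poly n) (x + 1) - poly (bernoulli_poly n) x) / fact n
       = x ^ (n - 1) / fact (n - 1)"
    using assms by (simp add: diff_divide_distrib)
  moreover have "(fact n :: 'a) = of_nat n * fact (n - 1)"
    using assms by (simp add: fact_reduce)
  ultimately show ?thesis
    using assms by (simp add: divide_eq_eq)
qed

lemma pderiv_bernoulli_poly:
  "pderiv (bernoulli_poly (Suc n) :: 'a::field_char_0 poly)
     = smult (of_nat (Suc n)) (bernoulli_poly n)"
proof -
  define c :: "nat \<Rightarrow> 'a" where "c = fps_nth (fps_X / (fps_exp 1 - 1))"
  have gf: "fps_nth bernoulli_gf k = (\<Sum>i=0..k. monom (c (k - i) / fact i) i)" for k
    by (simp add: bernoulli_gf_def fps_mult_nth c_def smult_monom mult.commute[of "monom _ _"])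
  have "pderiv (fps_nth bernoulli_gf (Suc n))
      = (\<Sum>i=0..Suc n. monom (of_nat i * (c (Suc n - i) / fact i)) (i - 1))"
    using higher_pderiv_sum[of 1 "\<lambda>i. monom (c (Suc n - i) / fact i) i" "{0..Suc n}"]
    by (simp del: sum.cl_ivl_Suc of_nat_Suc add: gf pderiv_monom)
  also have "\<dots> = (\<Sum>i=0..n. monom (of_nat (Suc i) * (c (n - i) / fact (Suc i))) i)"
    by (subst sum.atLeast0_atMost_Suc_shift) (simp del: of_nat_Suc fact_Suc)
  also have "\<dots> = fps_nth bernoulli_gf n"
    unfolding gf by (intro sum.cong refl) (simp del: of_nat_Suc)
  finally show ?thesis
    by (simp add: bernoulli_poly_def pderiv_smult)
qed

lemma has_unit_integral_bernoulli_poly: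
  assumes "n \<ge> 1"
  shows "has_unit_integral (bernoulli_poly n :: 'a::field_char_0 poly) 0"
proof -
  have "poly (bernoulli_poly (Suc n)) 1 = poly (bernoulli_poly (Suc n)) (0 :: 'a)"
    using bernoulli_poly_forward_difference[of "Suc n" "0 :: 'a"] assms
    by (simp add: power_0_left)
  thus ?thesis
    unfolding has_unit_integral_def
    by (intro exI[of _ "smult (1 / of_nat (Suc n)) (bernoulli_poly (Suc n))"])
       (simp add: pderiv_smult pderiv_bernoulli_poly del: of_nat_Suc)
qed

theorem lemma7:
  fixes m :: nat
  assumes "m \<ge> 1"
  shows "[:0, 1:] ^ m * (1 - [:0, 1:]) ^ m =
    [:1 / (of_nat (2 * m + 1) * of_nat ((2 * m) choose m)):] +
    smult ((- 1) ^ m)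
      (\<Sum>j = m + 1..2 * m.
        smult ((1 + (- 1) ^ j) / of_nat j * of_nat (m choose (j - m - 1)))
          (bernoulli_poly j :: 'a::field_char_0 poly))"
proof -
  define f :: "'a poly" where "f = [:0, 1:] ^ m * (1 - [:0, 1:]) ^ m"
  define a :: "nat \<Rightarrow> 'a" where
    "a j = (1 + (- 1) ^ j) / of_nat j * of_nat (m choose (j - m - 1))" for j
  define S where "S = smult ((- 1) ^ m) (\<Sum>j = m + 1..2 * m. smult (a j) (bernoulli_poly j))"

  have S_diff: "poly S (x + 1) - poly S x = (- 1) ^ m * x ^ m * ((x + 1) ^ m - (x - 1) ^ m)" for x
  proof -
    have "poly S (x + 1) - poly S x = (- 1) ^ m * (\<Sum>j = m + 1..2 * m.
            a j * (poly (bernoulli_poly j) (x + 1) - poly (bernoulli_poly j) x))"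
      by (simp add: S_def poly_sum right_diff_distrib sum_subtractf)
    also have "(\<Sum>j = m + 1..2 * m.
            a j * (poly (bernoulli_poly j) (x + 1) - poly (bernoulli_poly j) x))
        = (\<Sum>j = m + 1..2 * m. (1 + (- 1) ^ j) * of_nat (m choose (j - m - 1)) * x ^ (j - 1))"
      by (intro sum.cong refl) (simp add: a_def bernoulli_poly_forward_difference)
    also have "\<dots> = (\<Sum>k<m. (1 + (- 1) ^ (k + m + 1)) * of_nat (m choose k) * x ^ (k + m))"
      by (rule sum.reindex_bij_witness[of _ "\<lambda>k. k + m + 1" "\<lambda>j. j - m - 1"]) auto
    \<comment> \<open>The term for \<open>k = m\<close> has the factor \<open>1 + (-1)^(2m + 1) = 0\<close>, so it may be added.\<close>
    also have "\<dots> = (\<Sum>k\<le>m. (1 + (- 1) ^ (k + m + 1)) * of_nat (m choose k) * x ^ (k + m))"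
      by (simp add: lessThan_Suc_atMost[symmetric] flip: mult_2)
    also have "\<dots> = x ^ m * ((\<Sum>k\<le>m. of_nat (m choose k) * x ^ k * 1 ^ (m - k))
        - (\<Sum>k\<le>m. of_nat (m choose k) * x ^ k * (- 1) ^ (m - k)))"
    proof -
      have "(- 1 :: 'a) ^ (k + m + 1) = - ((- 1) ^ (m - k))" if "k \<le> m" for k
      proof -
        have "k + m + 1 = Suc ((m - k) + 2 * k)"
          using that by simp
        thus ?thesis
          by (simp only: power_Suc power_add power_mult) simp
      qed
      thus ?thesis
        unfolding sum_subtractf[symmetric] sum_distrib_left
        by (intro sum.cong refl) (simp add: power_add algebra_simps)
    qed
    also have "\<dots> = x ^ m * ((x + 1) ^ m - (x - 1) ^ m)"
      using binomial_ring[of x 1 m] binomial_ring[of x "- 1" m] by simp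
    finally show ?thesis
      by (simp add: mult.assoc)
  qed
  have f_diff: "poly f (x + 1) - poly f x = (- 1) ^ m * x ^ m * ((x + 1) ^ m - (x - 1) ^ m)" for x
  proof -
    have "(- x) ^ m = (- 1) ^ m * x ^ m" "(1 - x) ^ m = (- 1) ^ m * (x - 1) ^ m"
      by (simp_all flip: power_mult_distrib)
    thus ?thesis
      by (simp add: f_def algebra_simps)
  qed
  have "poly (f - S) (x + 1) = poly (f - S) x" for x
    using trans[OF f_diff[of x] S_diff[of x, symmetric]]
    by (simp only: poly_diff) (simp add: algebra_simps)
  then obtain d where d: "f - S = [:d:]"
    using periodic_poly_const by blast

  have "has_unit_integral S ((- 1) ^ m * (\<Sum>j = m + 1..2 * m. a j * 0))"
    unfolding S_def
    by (intro has_unit_integral_smult has_unit_integral_sum has_unit_integral_bernoulli_poly) simp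
  hence "has_unit_integral ([:d:] + S) (d + 0)"
    by (intro has_unit_integral_add has_unit_integral_const) simp
  moreover have "[:d:] + S = f"
    using d by (simp add: algebra_simps)
  moreover have "has_unit_integral f (fact m * fact m / fact (m + m + 1))"
    unfolding f_def by (rule has_unit_integral_beta)
  ultimately have "d = fact m * fact m / fact (m + m + 1)"
    using has_unit_integral_unique by force
  also have "\<dots> = 1 / (of_nat (2 * m + 1) * of_nat ((2 * m) choose m))"
    by (simp add: binomial_fact mult_2 del: of_nat_add of_nat_Suc)
  finally have "f = [:1 / (of_nat (2 * m + 1) * of_nat ((2 * m) choose m)):] + S"
    using \<open>[:d:] + S = f\<close> by simp
  thus ?thesis
    unfolding f_def S_def a_def .
qed

end
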